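(* Let $J\ge 3$. The family of adjacent models $\{(\text{adjacent},F,Z);\ F\in\mathfrak{F},\ Z\in\mathfrak{Z}\}$ and the family of cumulative models $\{(\text{cumulative},F,Z);\ F\in\mathfrak{F},\ Z\in\mathfrak{Z}\}$ are each stable under the reverse permutation $\tilde\sigma$ of $\{1,\dots,J\}$, $\tilde\sigma(j)=J-j+1$.
   Context: Setting. Let $J\ge 3$ (number of categories), $p\ge 1$, and let $\mathcal{X}\subseteq\mathbb{R}^p$ be the nonempty set of values of the explanatory vector $x$. Let $\mathcal{M}=\{\pi\in\,]0,1[^{J-1} : \sum_{j=1}^{J-1}\pi_j<1\}$; for $\pi\in\mathcal{M}$ put $\pi_J=1-\sum_{j=1}^{J-1}\pi_j$ ($\pi_j$ is the probability of category $j$). Ratios. The adjacent ratio $r:\mathcal{M}\to\,]0,1[^{J-1}$ is $r_j(\pi)=\pi_j/(\pi_j+\pi_{j+1})$; the cumulative ratio is $r_j(\pi)=\pi_1+\dots+\pi_j$, for $j=1,\dots,J-1$. Each is injective on $\mathcal{M}$. Cdfs. $\mathfrak{F}$ is the set of continuous cumulative distribution functions $F$ on $\mathbb{R}$ that are strictly increasing on the open interval $I_F=\{w: 0<F(w)<1\}$, so that $F$ maps $I_F$ bijectively onto $]0,1[$. Design matrices. The complete design matrix $Z_c(x)$ is the $(J-1)\times(J-1)(1+p)$ matrix with $Z_c(x)\beta=(\alpha_j+x^t\delta_j)_{j=1,\dots,J-1}$ for $\beta=(\alpha_1,\dots,\alpha_{J-1},\delta_1^t,\dots,\delta_{J-1}^t)^t$,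 $\alpha_j\in\mathbb{R}$, $\delta_j\in\mathbb{R}^p$. The set $\mathfrak{Z}$ of design matrices consists of all matrix functions $Z:x\mapsto Z_c(x)C$, where $C$ is a constant real matrix of full column rank with $q$ columns, $J-1+p\le q\le (J-1)(1+p)$. Models. A model $(r,F,Z)$, with $Z$ having $q$ columns, has as parameter space the set of $\beta\in\mathbb{R}^q$ such that for all $x\in\mathcal{X}$, $\eta=Z(x)\beta$ satisfies $\eta\in I_F^{J-1}$ and $(F(\eta_1),\dots,F(\eta_{J-1}))\in r(\mathcal{M})$. For such $\beta$ and $x\in\mathcal{X}$, it defines the unique $\pi=\pi(x;\beta)\in\mathcal{M}$ with $r(\pi)=(F(\eta_1),\dots,F(\eta_{J-1}))^t$, $\eta=Z(x)\beta$. Permuted models. For a permutation $\sigma$ of $\{1,\dots,J\}$ and $\pi\in\mathcal{M}$, let $\pi_\sigma=(\pi_{\sigma(1)},\dots,\pi_{\sigma(J-1)})\in\mathcal{M}$. The permuted model $(r,F,Z)_\sigma$ has the same parameter space as $(r,F,Z)$ and defines $\pi=\pi(x;\beta)\in\mathcal{M}$ by $r(\pi_\sigma)=(F(\eta_1),\dots,F(\eta_{J-1}))^t$, $\eta=Z(x)\beta$. Two (possibly permuted) models are equal if they have the same parameter space and give the same $\pi(x;\beta)$ for all $x\in\mathcal{X}$ and all $\beta$ in it. A family of models $\mathfrak{M}$ is stable under $\sigma$ if $\sigma(\mathfrak{M})=\mathfrak{M}$, where $\sigma(\mathfrak{M})=\{(r,F,Z)_\sigma : (r,F,Z)\in\mathfrak{M}\}$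 and equal models are identified (i.e. every model of each of the two sets is equal to some model of the other). *)

theory Defs
  imports
    "HOL-Probability.Distribution_Functions"
    "Jordan_Normal_Form.DL_Rank"
begin

unbundle no vec_syntax

text \<open>
  Vectors and matrices are those of \<^theory>\<open>Jordan_Normal_Form.Matrix\<close>, whose indices start at 0,
  whereas categories and permutations use the indices 1, ..., J. Hence entry \<open>i\<close> of a vector of
  length \<open>J - 1\<close> belongs to category \<open>i + 1\<close>.
\<close>

definition prob_vecs :: "nat \<Rightarrow> real vec set" where
  "prob_vecs J = {\<pi> \<in> carrier_vec (J - 1).
     (\<forall>i < J - 1. 0 < \<pi> $ i \<and> \<pi> $ i < 1) \<and> (\<Sum>i < J - 1. \<pi> $ i) < 1}"

definition cat_prob :: "nat \<Rightarrow> real vec \<Rightarrow> nat \<Rightarrow> real" where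
  "cat_prob J \<pi> j = (if j = J then 1 - (\<Sum>i < J - 1. \<pi> $ i) else \<pi> $ (j - 1))"

definition permute_vec :: "nat \<Rightarrow> (nat \<Rightarrow> nat) \<Rightarrow> real vec \<Rightarrow> real vec" where
  "permute_vec J \<sigma> \<pi> = vec (J - 1) (\<lambda>i. cat_prob J \<pi> (\<sigma> (i + 1)))"

definition adjacent_ratio :: "nat \<Rightarrow> real vec \<Rightarrow> real vec" where
  "adjacent_ratio J \<pi> = vec (J - 1)
     (\<lambda>i. cat_prob J \<pi> (i + 1) / (cat_prob J \<pi> (i + 1) + cat_prob J \<pi> (i + 2)))"

definition cumulative_ratio :: "nat \<Rightarrow> real vec \<Rightarrow> real vec" where
  "cumulative_ratio J \<pi> = vec (J - 1) (\<lambda>i. \<Sum>j = 1..i + 1. cat_prob J \<pi> j)"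

definition open_support :: "(real \<Rightarrow> real) \<Rightarrow> real set" where
  "open_support F = {w. 0 < F w \<and> F w < 1}"

definition link_cdfs :: "(real \<Rightarrow> real) set" where
  "link_cdfs = {F. (\<exists>\<mu>. real_distribution \<mu> \<and> F = cdf \<mu>) \<and>
     continuous_on UNIV F \<and> strict_mono_on (open_support F) F}"

text \<open>
  The parameter vector is ordered as the intercepts \<open>\<alpha>\<close> followed by the blocks \<open>\<delta>\<close>, one block of
  length \<open>p\<close> for each row; the lemma below spells out the linear predictor that results.
\<close>

definition complete_design :: "nat \<Rightarrow> nat \<Rightarrow> real vec \<Rightarrow> real mat" where
  "complete_design J p x = mat (J - 1) ((J - 1) * (1 + p))
     (\<lambda>(i, c). if c < J - 1 then (if c = i then 1 else 0)
        else if (c - (J - 1)) div p = i then x $ ((c - (J - 1)) mod p) else 0)"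

lemma complete_design_mult:
  assumes x: "x \<in> carrier_vec p" and \<beta>: "\<beta> \<in> carrier_vec ((J - 1) * (1 + p))" and i: "i < J - 1"
  shows "(complete_design J p x *\<^sub>v \<beta>) $ i =
    \<beta> $ i + x \<bullet> vec p (\<lambda>k. \<beta> $ ((J - 1) + i * p + k))"
proof -
  define n where "n = J - 1"
  define f where "f c = (if c < n then (if c = i then 1 else 0)
        else if (c - n) div p = i then x $ ((c - n) mod p) else 0) * \<beta> $ c" for c
  have i': "i < n" using i n_def by simp
  have "(complete_design J p x *\<^sub>v \<beta>) $ i = (\<Sum>c = 0..<n * (1 + p). f c)"
    using \<beta> i by (auto simp: complete_design_def scalar_prod_def f_def n_def intro!: sum.cong)
  also have "\<dots> = (\<Sum>c = 0..<n. f c) + (\<Sum>c = n..<n + n * p. f c)"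
    by (simp add: sum.atLeastLessThan_concat)
  also have "(\<Sum>c = 0..<n. f c) = (\<Sum>c = 0..<n. if c = i then \<beta> $ c else 0)"
    by (intro sum.cong) (auto simp: f_def)
  also have "\<dots> = \<beta> $ i" using i' by simp
  also have "(\<Sum>c = n..<n + n * p. f c) = (\<Sum>c \<in> {n + i * p..<n + i * p + p}. f c)"
  proof (rule sum.mono_neutral_right)
    have "i * p + p \<le> n * p"
      using i' mult_le_mono1[of "Suc i" n p] by simp
    then show "{n + i * p..<n + i * p + p} \<subseteq> {n..<n + n * p}" by auto
    show "\<forall>c \<in> {n..<n + n * p} - {n + i * p..<n + i * p + p}. f c = 0"
    proof
      fix c assume c: "c \<in> {n..<n + n * p} - {n + i * p..<n + i * p + p}"
      have "p > 0" using c by (cases p) auto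
      have "(c - n) div p \<noteq> i"
      proof
        assume "(c - n) div p = i"
        then have "c - n = i * p + (c - n) mod p" by (metis div_mult_mod_eq)
        moreover have "(c - n) mod p < p" using \<open>p > 0\<close> by simp
        ultimately show False using c by auto
      qed
      then show "f c = 0" using c by (auto simp: f_def)
    qed
  qed simp
  also have "\<dots> = (\<Sum>k = 0..<p. f (n + i * p + k))"
    using sum.shift_bounds_nat_ivl[of f 0 "n + i * p" p]
    by (simp add: add.commute add.left_commute)
  also have "\<dots> = (\<Sum>k = 0..<p. x $ k * \<beta> $ (n + i * p + k))"
    by (intro sum.cong) (auto simp: f_def)
  finally show ?thesis by (simp add: scalar_prod_def n_def)
qed

definition designs :: "nat \<Rightarrow> nat \<Rightarrow> nat \<Rightarrow> (real vec \<Rightarrow> real mat) set" where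
  "designs J p q = {Z. \<exists>C \<in> carrier_mat ((J - 1) * (1 + p)) q.
     vec_space.rank ((J - 1) * (1 + p)) C = q \<and> Z = (\<lambda>x. complete_design J p x * C)}"

text \<open>
  A possibly permuted model: ratio, cdf, number of columns of the design matrix, design matrix,
  permutation. An unpermuted model carries the identity.
\<close>

datatype model = Model (ratio: "real vec \<Rightarrow> real vec") (link: "real \<Rightarrow> real")
  (n_params: nat) (design: "real vec \<Rightarrow> real mat") (perm: "nat \<Rightarrow> nat")

definition predictor :: "model \<Rightarrow> real vec \<Rightarrow> real vec \<Rightarrow> real vec" where
  "predictor m x \<beta> = design m x *\<^sub>v \<beta>"

definition param_space :: "nat \<Rightarrow> real vec set \<Rightarrow> model \<Rightarrow> real vec set" where
  "param_space J X m = {\<beta> \<in> carrier_vec (n_params m). \<forall>x \<in> X.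
     (\<forall>i < J - 1. predictor m x \<beta> $ i \<in> open_support (link m)) \<and>
     map_vec (link m) (predictor m x \<beta>) \<in> ratio m ` prob_vecs J}"

definition model_prob :: "nat \<Rightarrow> model \<Rightarrow> real vec \<Rightarrow> real vec \<Rightarrow> real vec" where
  "model_prob J m x \<beta> = (THE \<pi>. \<pi> \<in> prob_vecs J \<and>
     ratio m (permute_vec J (perm m) \<pi>) = map_vec (link m) (predictor m x \<beta>))"

text \<open>
  The parameter space is a subset of the real space of dimension \<^const>\<open>n_params\<close>, so the dimensions
  are compared as well; this matters only when the parameter spaces are empty.
\<close>

definition model_eq :: "nat \<Rightarrow> real vec set \<Rightarrow> model \<Rightarrow> model \<Rightarrow> bool" where
  "model_eq J X m m' \<longleftrightarrow> n_params m = n_params m' \<and> param_space J X m = param_space J X m' \<and>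
     (\<forall>x \<in> X. \<forall>\<beta> \<in> param_space J X m. model_prob J m x \<beta> = model_prob J m' x \<beta>)"

text \<open>
  Since \<open>(\<pi>\<^sub>\<sigma>)\<^sub>\<tau> = \<pi>\<^bsub>\<sigma> \<circ> \<tau>\<^esub>\<close>, permuting by \<open>\<sigma>\<close> a model that carries \<open>\<tau>\<close> gives one carrying \<open>\<sigma> \<circ> \<tau>\<close>.
\<close>

definition permute_model :: "(nat \<Rightarrow> nat) \<Rightarrow> model \<Rightarrow> model" where
  "permute_model \<sigma> m = Model (ratio m) (link m) (n_params m) (design m) (\<sigma> \<circ> perm m)"

definition stable_under :: "nat \<Rightarrow> real vec set \<Rightarrow> (nat \<Rightarrow> nat) \<Rightarrow> model set \<Rightarrow> bool" where
  "stable_under J X \<sigma> \<MM> \<longleftrightarrow>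
     (\<forall>m \<in> permute_model \<sigma> ` \<MM>. \<exists>m' \<in> \<MM>. model_eq J X m m') \<and>
     (\<forall>m' \<in> \<MM>. \<exists>m \<in> permute_model \<sigma> ` \<MM>. model_eq J X m' m)"

definition model_family :: "nat \<Rightarrow> nat \<Rightarrow> (real vec \<Rightarrow> real vec) \<Rightarrow> model set" where
  "model_family J p r = {Model r F q Z id | F q Z. F \<in> link_cdfs \<and>
     J - 1 + p \<le> q \<and> q \<le> (J - 1) * (1 + p) \<and> Z \<in> designs J p q}"

definition reverse_perm :: "nat \<Rightarrow> nat \<Rightarrow> nat" where
  "reverse_perm J j = (if j \<in> {1..J} then J - j + 1 else j)"

end

theory Submission
  imports Defs
begin

text \<open>
  Reversing the categories replaces entry \<open>i\<close> of either ratio by one minus entry \<open>J - i\<close>. Hence the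
  reversed model of \<open>(r, F, Z)\<close> is \<open>(r, F', Z')\<close>, where \<open>F' w = 1 - F (- w)\<close> is the cdf of the
  reflected distribution and \<open>Z'\<close> is \<open>- Z\<close> with its rows in reverse order. Reversing the rows of the
  complete design matrix amounts to permuting its columns, so \<open>Z'\<close> is obtained from the constant
  matrix \<open>- C\<close> with permuted rows, which has the same rank as \<open>C\<close>. Both operations are involutions,
  which gives the two inclusions.
\<close>

section \<open>Full column rank\<close>

context vec_space
begin

text \<open>The rank is the size of a maximal independent subset of the set of columns, and a
  repeated column would leave that set with fewer than \<open>nc\<close> elements.\<close>

lemma full_rank_imp_distinct_cols:
  assumes A: "A \<in> carrier_mat n nc" and "rank A = nc"
  shows "distinct (cols A)"
proof -
  \<comment> \<open>A maximal set exists because the empty set is independent and cardinalities are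
    bounded by the number of columns.\<close>
  obtain S where S: "maximal S (\<lambda>T. T \<subseteq> set (cols A) \<and> lin_indpt T)"
    using maximal_exists[of "\<lambda>T. T \<subseteq> set (cols A) \<and> lin_indpt T" "card (set (cols A))" "{}"]
    by (meson List.finite_set card_mono empty_iff empty_subsetI finite_lin_indpt2 rev_finite_subset)
  then have "S \<subseteq> set (cols A)" by (simp add: maximal_def)
  moreover have "nc = card S"
    using rank_card_indpt[OF A S] assms(2) by simp
  ultimately have "length (cols A) \<le> card (set (cols A))"
    using A card_mono[of "set (cols A)" S] by simp
  then show ?thesis
    using card_length[of "cols A"] by (intro card_distinct) simp
qed

text \<open>Turns the rank condition in \<open>designs\<close> into one that can be checked directly
  after permuting rows and changing signs. Independence concerns the set of columns, so each
  direction first establishes that the columns are distinct.\<close>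

lemma full_rank_iff_trivial_kernel:
  assumes A: "A \<in> carrier_mat n nc"
  shows "rank A = nc \<longleftrightarrow> (\<forall>v \<in> carrier_vec nc. A *\<^sub>v v = 0\<^sub>v n \<longrightarrow> v = 0\<^sub>v nc)"
proof
  assume r: "rank A = nc"
  then have "distinct (cols A)" using full_rank_imp_distinct_cols[OF A] by simp
  then show "\<forall>v \<in> carrier_vec nc. A *\<^sub>v v = 0\<^sub>v n \<longrightarrow> v = 0\<^sub>v nc"
    using full_rank_lin_indpt[OF A r] lin_depI[OF A] by blast
next
  assume ker: "\<forall>v \<in> carrier_vec nc. A *\<^sub>v v = 0\<^sub>v n \<longrightarrow> v = 0\<^sub>v nc"
  have d: "distinct (cols A)"
  proof (rule ccontr)
    assume "\<not> distinct (cols A)"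
    then obtain i j where ij: "i < nc" "j < nc" "i \<noteq> j" "col A i = col A j"
      using A by (auto simp: distinct_conv_nth)
    \<comment> \<open>Two equal columns put the difference of their unit vectors into the
      kernel.\<close>
    define v :: "'a vec" where "v = unit_vec nc i - unit_vec nc j"
    have "A *\<^sub>v unit_vec nc k = col A k" if "k < nc" for k
      using A that by (intro eq_vecI) auto
    then have "A *\<^sub>v v = col A i - col A j"
      using ij unfolding v_def by (subst mult_minus_distrib_mat_vec[OF A]) auto
    also have "\<dots> = 0\<^sub>v n" using A ij by (intro eq_vecI) auto
    finally have "v = 0\<^sub>v nc" using ker by (simp add: v_def)
    moreover have "v $ i = 1" using ij by (simp add: v_def)
    ultimately show False using ij by simp
  qed
  have "lin_indpt (set (cols A))"
    using ker by (auto elim: lin_depE[OF A _ d])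
  then show "rank A = nc" by (rule lin_indpt_full_rank[OF A d])
qed

end

section \<open>Reflected link functions\<close>

definition reflect :: "(real \<Rightarrow> real) \<Rightarrow> real \<Rightarrow> real" where
  "reflect F w = 1 - F (- w)"

lemma reflect_reflect [simp]: "reflect (reflect F) = F"
  by (simp add: reflect_def fun_eq_iff)

lemma open_support_reflect: "w \<in> open_support (reflect F) \<longleftrightarrow> - w \<in> open_support F"
  by (auto simp: open_support_def reflect_def)

text \<open>Monotone, right continuous, with limits 0 and 1: this makes \<open>reflect F\<close> the
  cdf of its own interval measure. The two limits are those of \<open>F\<close> with the ends of the
  line exchanged.\<close>

lemma reflect_in_link_cdfs:
  assumes "F \<in> link_cdfs"
  shows "reflect F \<in> link_cdfs"
proof -
  obtain \<mu> where \<mu>: "real_distribution \<mu>" and F: "F = cdf \<mu>"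
    and cont: "continuous_on UNIV F" and mono: "strict_mono_on (open_support F) F"
    using assms by (auto simp: link_cdfs_def)
  interpret real_distribution \<mu> by fact
  have cont': "continuous_on UNIV (reflect F)"
    unfolding reflect_def
    by (intro continuous_intros continuous_on_compose2[OF cont]) auto
  have nondec: "reflect F x \<le> reflect F y" if "x \<le> y" for x y
    using that cdf_nondecreasing[of "- y" "- x"] by (simp add: reflect_def F)
  \<comment> \<open>Reflection exchanges left and right limits, so right continuity comes from the
    two-sided continuity of \<open>F\<close>.\<close>
  have rc: "continuous (at_right a) (reflect F)" for a
    using cont' by (simp add: continuous_on_eq_continuous_at continuous_at_imp_continuous_at_within)
  have bot: "(reflect F \<longlongrightarrow> 0) at_bot"
    using tendsto_diff[OF tendsto_const[of 1]
        filterlim_compose[OF cdf_lim_at_top_prob filterlim_uminus_at_top_at_bot]]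
    by (simp add: reflect_def[abs_def] F)
  have top: "(reflect F \<longlongrightarrow> 1) at_top"
    using tendsto_diff[OF tendsto_const[of 1]
        filterlim_compose[OF cdf_lim_at_bot filterlim_uminus_at_bot_at_top]]
    by (simp add: reflect_def[abs_def] F)
  have "real_distribution (interval_measure (reflect F))"
    using nondec rc bot top by (rule real_distribution_interval_measure)
  moreover have "reflect F = cdf (interval_measure (reflect F))"
    using cdf_interval_measure[OF nondec rc bot] by simp
  moreover have "strict_mono_on (open_support (reflect F)) (reflect F)"
  proof (rule strict_mono_onI)
    fix x y assume "x \<in> open_support (reflect F)" "y \<in> open_support (reflect F)" "x < y"
    then show "reflect F x < reflect F y"
      \<comment> \<open>The order is reversed twice, by the inner and by the outer minus
        sign.\<close>
      using strict_mono_onD[OF mono, of "- y" "- x"]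
      by (simp add: open_support_reflect reflect_def)
  qed
  ultimately show ?thesis using cont' unfolding link_cdfs_def by blast
qed

section \<open>Reversed design matrices\<close>

text \<open>The sign cancels the one inside \<open>reflect\<close>. Rows count from 0, whence the
  index \<open>dim_row (Z x) - 1 - i\<close>.\<close>

definition neg_reverse_rows :: "(real vec \<Rightarrow> real mat) \<Rightarrow> real vec \<Rightarrow> real mat" where
  "neg_reverse_rows Z x = mat (dim_row (Z x)) (dim_col (Z x))
     (\<lambda>(i, j). - Z x $$ (dim_row (Z x) - 1 - i, j))"

lemma neg_reverse_rows_neg_reverse_rows [simp]: "neg_reverse_rows (neg_reverse_rows Z) = Z"
  by (rule ext, rule eq_matI) (auto simp: neg_reverse_rows_def)

text \<open>
  The permutation of the parameter indices that reverses the order of the intercepts and, keeping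
  each slope vector intact, the order of the slope blocks.
\<close>

definition reverse_blocks :: "nat \<Rightarrow> nat \<Rightarrow> nat \<Rightarrow> nat" where
  "reverse_blocks n p c = (if c < n then n - 1 - c
     else n + (n - 1 - (c - n) div p) * p + (c - n) mod p)"

lemma block_div_less:
  fixes n p c :: nat
  assumes "c < n * (1 + p)" "\<not> c < n"
  shows "(c - n) div p < n" "0 < p"
proof -
  show "0 < p" using assms by (cases p) auto
  then show "(c - n) div p < n"
    using assms by (simp add: div_less_iff_less_mult)
qed

lemma reverse_blocks_div_mod:
  assumes "\<not> c < n" "0 < p"
  shows "(reverse_blocks n p c - n) div p = n - 1 - (c - n) div p"
    "(reverse_blocks n p c - n) mod p = (c - n) mod p"
    "\<not> reverse_blocks n p c < n"
  using assms by (auto simp: reverse_blocks_def)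

lemma reverse_blocks_less:
  assumes c: "c < n * (1 + p)"
  shows "reverse_blocks n p c < n * (1 + p)"
proof (cases "c < n")
  case True
  then have "reverse_blocks n p c < n" by (auto simp: reverse_blocks_def)
  then show ?thesis by (simp add: less_le_trans)
next
  case False
  note b = block_div_less[OF c False]
  have "(n - 1 - (c - n) div p) * p + (c - n) mod p < n * p"
  proof -
    have "Suc (n - 1 - (c - n) div p) * p \<le> n * p"
      using b by (intro mult_le_mono1) auto
    moreover have "(c - n) mod p < p" using b by simp
    ultimately show ?thesis by simp
  qed
  then show ?thesis using False by (simp add: reverse_blocks_def)
qed

lemma reverse_blocks_involution:
  assumes c: "c < n * (1 + p)"
  shows "reverse_blocks n p (reverse_blocks n p c) = c"
proof (cases "c < n")
  case True
  then show ?thesis by (auto simp: reverse_blocks_def)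
next
  case False
  note b = block_div_less[OF c False]
  note r = reverse_blocks_div_mod[OF False b(2)]
  have "reverse_blocks n p (reverse_blocks n p c) =
      n + (n - 1 - (n - 1 - (c - n) div p)) * p + (c - n) mod p"
    using r by (subst reverse_blocks_def) simp
  also have "\<dots> = n + ((c - n) div p * p + (c - n) mod p)" using b by simp
  also have "\<dots> = c" using False by simp
  finally show ?thesis .
qed

text \<open>An entry depends on whether its block number equals its row number and on the position
  inside the block. Reversing the block number has the same effect on this test as reversing the row
  number, and the position is kept.\<close>

lemma complete_design_reverse_blocks:
  assumes n: "n = J - 1" and c: "c < n * (1 + p)" and i: "i < n"
  shows "complete_design J p x $$ (i, reverse_blocks n p c) =
    complete_design J p x $$ (n - 1 - i, c)"
proof -
  have entry: "complete_design J p x $$ (i, c) = (if c < n then (if c = i then 1 else 0)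
      else if (c - n) div p = i then x $ ((c - n) mod p) else 0)"
    if "i < n" "c < n * (1 + p)" for i c
    using that by (simp only: complete_design_def n index_mat split)
  have i': "n - 1 - i < n" using i by simp
  show ?thesis
  proof (cases "c < n")
    case True
    then have "reverse_blocks n p c < n" "reverse_blocks n p c = i \<longleftrightarrow> c = n - 1 - i"
      using i by (auto simp: reverse_blocks_def)
    then show ?thesis
      using True by (simp only: entry[OF i reverse_blocks_less[OF c]] entry[OF i' c] if_True)
  next
    case False
    note b = block_div_less[OF c False]
    note r = reverse_blocks_div_mod[OF False b(2)]
    have "n - 1 - (c - n) div p = i \<longleftrightarrow> (c - n) div p = n - 1 - i"
      using b(1) i by auto
    then show ?thesis
      using False r
      by (simp only: entry[OF i reverse_blocks_less[OF c]] entry[OF i' c] if_False)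
  qed
qed

lemma complete_design_carrier:
  "complete_design J p x \<in> carrier_mat (J - 1) ((J - 1) * (1 + p))"
  by (simp add: complete_design_def)

lemma designs_carrier:
  assumes "Z \<in> designs J p q"
  shows "Z x \<in> carrier_mat (J - 1) q"
  using assms mult_carrier_mat[OF complete_design_carrier] unfolding designs_def by blast

lemma neg_reverse_rows_in_designs:
  assumes "Z \<in> designs J p q"
  shows "neg_reverse_rows Z \<in> designs J p q"
proof -
  define n where "n = J - 1"
  define N where "N = n * (1 + p)"
  define \<tau> where "\<tau> = reverse_blocks n p"
  obtain C where C: "C \<in> carrier_mat N q" and rank: "vec_space.rank N C = q"
    and Z: "Z = (\<lambda>x. complete_design J p x * C)"
    using assms by (auto simp: designs_def N_def n_def)
  \<comment> \<open>The row permutation of the constant factor is chosen to match the column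
    permutation of the complete design.\<close>
  define C' where "C' = mat N q (\<lambda>(c, j). - C $$ (\<tau> c, j))"
  have C': "C' \<in> carrier_mat N q" by (simp add: C'_def)
  have \<tau>: "\<tau> c < N" "\<tau> (\<tau> c) = c" if "c < N" for c
    using that reverse_blocks_less reverse_blocks_involution by (auto simp: N_def \<tau>_def)
  have bij: "bij_betw \<tau> {0..<N} {0..<N}"
    by (rule bij_betw_byWitness[where f' = \<tau>]) (auto simp: \<tau>)
  have "vec_space.rank N C' = q"
    unfolding vec_space.full_rank_iff_trivial_kernel[OF C']
  proof (intro ballI impI)
    fix v :: "real vec" assume v: "v \<in> carrier_vec q" and 0: "C' *\<^sub>v v = 0\<^sub>v N"
    \<comment> \<open>The entries of \<open>C *\<^sub>v v\<close> are those of
      \<open>C' *\<^sub>v v\<close>, permuted and negated, so the kernel of \<open>C'\<close> lies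
      in that of \<open>C\<close>.\<close>
    have "C *\<^sub>v v = 0\<^sub>v N"
    proof (rule eq_vecI)
      fix c assume "c < dim_vec (0\<^sub>v N :: real vec)"
      then have c: "c < N" by simp
      have "(C *\<^sub>v v) $ c = - (C' *\<^sub>v v) $ \<tau> c"
        using C C' v c \<tau>[OF c]
        by (simp add: scalar_prod_def C'_def sum_negf)
      then show "(C *\<^sub>v v) $ c = 0\<^sub>v N $ c" using 0 c \<tau>[OF c] by simp
    qed (use C in simp)
    then show "v = 0\<^sub>v q"
      using rank v vec_space.full_rank_iff_trivial_kernel[OF C] by blast
  qed
  moreover have "neg_reverse_rows Z = (\<lambda>x. complete_design J p x * C')"
  proof (rule ext)
    fix x
    let ?D = "complete_design J p x"
    have D: "?D \<in> carrier_mat n N"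
      unfolding n_def N_def by (rule complete_design_carrier)
    show "neg_reverse_rows Z x = ?D * C'"
    proof (rule eq_matI)
      fix i j assume "i < dim_row (?D * C')" "j < dim_col (?D * C')"
      then have i: "i < n" and j: "j < q" using D C' by auto
      have "(?D * C') $$ (i, j) = (\<Sum>c = 0..<N. ?D $$ (i, c) * C' $$ (c, j))"
        using D C' i j by (simp add: scalar_prod_def)
      \<comment> \<open>Summing along \<open>\<tau>\<close> turns the permuted columns of the design
        into a reversed row, while the second \<open>\<tau>\<close> restores the original row of
        \<open>C\<close>.\<close>
      also have "\<dots> = (\<Sum>c = 0..<N. ?D $$ (i, \<tau> c) * C' $$ (\<tau> c, j))"
        by (rule sum.reindex_bij_betw[OF bij, symmetric])
      also have "\<dots> = (\<Sum>c = 0..<N. - (?D $$ (n - 1 - i, c) * C $$ (c, j)))"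
      proof (rule sum.cong)
        fix c assume "c \<in> {0..<N}"
        then have c: "c < N" by simp
        then show "?D $$ (i, \<tau> c) * C' $$ (\<tau> c, j) = - (?D $$ (n - 1 - i, c) * C $$ (c, j))"
          using j complete_design_reverse_blocks[OF n_def c[unfolded N_def] i, of x] \<tau>[OF c]
          by (simp add: C'_def \<tau>_def[symmetric])
      qed simp
      also have "\<dots> = - (?D * C) $$ (n - 1 - i, j)"
        using D C i j by (simp add: scalar_prod_def sum_negf)
      also have "\<dots> = neg_reverse_rows Z x $$ (i, j)"
        using D C i j by (simp add: neg_reverse_rows_def Z)
      finally show "neg_reverse_rows Z x $$ (i, j) = (?D * C') $$ (i, j)" ..
    qed (use D C C' in \<open>auto simp: neg_reverse_rows_def Z\<close>)
  qed
  ultimately show ?thesis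
    using C' unfolding designs_def N_def n_def by blast
qed

section \<open>Reversed probability vectors\<close>

text \<open>The action of category reversal on ratio vectors. Entry J - i, counted from 1, is entry
  \<open>n - 1 - i\<close> counted from 0 when \<open>n = J - 1\<close>.\<close>

definition reverse_complement :: "nat \<Rightarrow> real vec \<Rightarrow> real vec" where
  "reverse_complement n y = vec n (\<lambda>i. 1 - y $ (n - 1 - i))"

lemma reverse_complement_carrier [simp]: "reverse_complement n y \<in> carrier_vec n"
  by (simp add: reverse_complement_def)

lemma reverse_complement_involution:
  "y \<in> carrier_vec n \<Longrightarrow> reverse_complement n (reverse_complement n y) = y"
  by (rule eq_vecI) (auto simp: reverse_complement_def)

lemma permute_vec_id:
  assumes "\<pi> \<in> prob_vecs J"
  shows "permute_vec J id \<pi> = \<pi>"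
  using assms by (intro eq_vecI) (auto simp: permute_vec_def cat_prob_def prob_vecs_def)

lemma sum_cat_prob:
  assumes "J \<ge> 1"
  shows "(\<Sum>j = 1..J. cat_prob J \<pi> j) = 1"
proof -
  obtain n where J: "J = Suc n" using assms by (cases J) auto
  have "(\<Sum>j = 1..n. cat_prob J \<pi> j) = (\<Sum>i < n. \<pi> $ i)"
    by (rule sum.reindex_bij_witness[where i = Suc and j = "\<lambda>j. j - 1"])
      (auto simp: cat_prob_def J)
  then show ?thesis by (simp add: J) (simp add: cat_prob_def)
qed

lemma cat_prob_bounds:
  assumes \<pi>: "\<pi> \<in> prob_vecs J" and J: "J \<ge> 2" and j: "j \<in> {1..J}"
  shows "0 < cat_prob J \<pi> j" "cat_prob J \<pi> j < 1"
proof -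
  \<comment> \<open>Category \<open>J\<close> carries the remaining mass, so its upper bound amounts
    to this sum being positive; it is nonempty as \<open>J \<ge> 2\<close>.\<close>
  have "0 < (\<Sum>i < J - 1. \<pi> $ i)"
    using \<pi> J by (intro sum_pos) (auto simp: prob_vecs_def lessThan_empty_iff)
  then show "0 < cat_prob J \<pi> j" "cat_prob J \<pi> j < 1"
    using \<pi> j by (auto simp: cat_prob_def prob_vecs_def)
qed

text \<open>The first \<open>k\<close> categories in reversed order are the last \<open>k\<close>,
  and the total mass is 1.\<close>

lemma sum_cat_prob_reverse:
  assumes "J \<ge> 1" and "k \<le> J"
  shows "(\<Sum>j = 1..k. cat_prob J \<pi> (J - j + 1)) = 1 - (\<Sum>j = 1..J - k. cat_prob J \<pi> j)"
proof -
  have "(\<Sum>j = 1..k. cat_prob J \<pi> (J - j + 1)) = (\<Sum>j = J - k + 1..J. cat_prob J \<pi> j)"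
    using assms
    by (intro sum.reindex_bij_witness[where i = "\<lambda>j. J - j + 1" and j = "\<lambda>j. J - j + 1"]) auto
  moreover have "(\<Sum>j = 1..J. cat_prob J \<pi> j) =
      (\<Sum>j = 1..J - k. cat_prob J \<pi> j) + (\<Sum>j = J - k + 1..J. cat_prob J \<pi> j)"
    using sum.ub_add_nat[of 1 "J - k" "cat_prob J \<pi>" k] assms by simp
  ultimately show ?thesis using sum_cat_prob[of J \<pi>] assms by simp
qed

lemma cat_prob_reverse:
  assumes "J \<ge> 1" and j: "j \<in> {1..J}"
  shows "cat_prob J (permute_vec J (reverse_perm J) \<pi>) j = cat_prob J \<pi> (J - j + 1)"
proof (cases "j = J")
  case True
  \<comment> \<open>Category \<open>J\<close> of the permuted vector is no entry but a remainder;
    removing the last \<open>J - 1\<close> categories of \<pi> from the total leaves category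
    1.\<close>
  have "(\<Sum>i < J - 1. permute_vec J (reverse_perm J) \<pi> $ i) =
      (\<Sum>j = 1..J - 1. cat_prob J \<pi> (J - j + 1))"
    by (rule sum.reindex_bij_witness[where i = "\<lambda>j. j - 1" and j = Suc])
      (auto simp: permute_vec_def reverse_perm_def)
  then show ?thesis
    using True assms(1) sum_cat_prob_reverse[of J "J - 1" \<pi>]
    by (simp add: cat_prob_def[of J "permute_vec J (reverse_perm J) \<pi>"])
next
  case False
  then show ?thesis
    using j by (subst cat_prob_def) (auto simp: permute_vec_def reverse_perm_def)
qed

lemma permute_vec_reverse_in_prob_vecs:
  assumes \<pi>: "\<pi> \<in> prob_vecs J" and J: "J \<ge> 2"
  shows "permute_vec J (reverse_perm J) \<pi> \<in> prob_vecs J"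
proof -
  let ?\<rho> = "permute_vec J (reverse_perm J) \<pi>"
  have "?\<rho> $ i = cat_prob J \<pi> (J - i)" if "i < J - 1" for i
  proof -
    have "reverse_perm J (i + 1) = J - i" using that by (auto simp: reverse_perm_def)
    then show ?thesis using that by (simp add: permute_vec_def)
  qed
  \<comment> \<open>This is the condition that the entries sum to less than 1: the new remainder is
    the old category 1.\<close>
  moreover have "0 < cat_prob J ?\<rho> J"
    using cat_prob_reverse[of J J \<pi>] cat_prob_bounds[OF \<pi> J, of 1] J by simp
  ultimately show ?thesis
    using cat_prob_bounds[OF \<pi> J] by (auto simp: prob_vecs_def cat_prob_def permute_vec_def)
qed

text \<open>Reversal keeps neighbours adjacent but exchanges their roles, so a/(a+b) becomes
  b/(a+b), its complement to 1. Positive probabilities keep the denominator nonzero.\<close>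

lemma adjacent_ratio_reverse:
  assumes \<pi>: "\<pi> \<in> prob_vecs J" and J: "J \<ge> 2"
  shows "adjacent_ratio J (permute_vec J (reverse_perm J) \<pi>) =
    reverse_complement (J - 1) (adjacent_ratio J \<pi>)"
proof (rule eq_vecI)
  fix i assume "i < dim_vec (reverse_complement (J - 1) (adjacent_ratio J \<pi>))"
  then have i: "i < J - 1" by (simp add: reverse_complement_def)
  let ?c = "cat_prob J \<pi>"
  have "0 < ?c (J - i)" "0 < ?c (J - 1 - i)"
    using i by (auto intro!: cat_prob_bounds[OF \<pi> J])
  then have pos: "?c (J - i) + ?c (J - 1 - i) \<noteq> 0" by simp
  have "adjacent_ratio J (permute_vec J (reverse_perm J) \<pi>) $ i =
      ?c (J - i) / (?c (J - i) + ?c (J - 1 - i))"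
    using i J cat_prob_reverse[of J "i + 1" \<pi>] cat_prob_reverse[of J "i + 2" \<pi>]
    by (simp add: adjacent_ratio_def Suc_diff_Suc numeral_2_eq_2)
  also have "\<dots> = 1 - ?c (J - 1 - i) / (?c (J - 1 - i) + ?c (J - i))"
    using pos by (simp add: field_simps)
  also have "\<dots> = 1 - adjacent_ratio J \<pi> $ (J - 1 - 1 - i)"
  proof -
    have "J - 1 - i = J - 1 - 1 - i + 1" "J - i = J - 1 - 1 - i + 2" using i by auto
    moreover have "J - 1 - 1 - i < J - 1" using i by simp
    ultimately show ?thesis by (simp only: adjacent_ratio_def index_vec)
  qed
  finally show "adjacent_ratio J (permute_vec J (reverse_perm J) \<pi>) $ i =
      reverse_complement (J - 1) (adjacent_ratio J \<pi>) $ i"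
    using i by (simp add: reverse_complement_def)
qed (simp add: adjacent_ratio_def reverse_complement_def)

text \<open>Accumulating from the other end gives one minus the mass of the categories not yet
  reached.\<close>

lemma cumulative_ratio_reverse:
  "cumulative_ratio J (permute_vec J (reverse_perm J) \<pi>) =
    reverse_complement (J - 1) (cumulative_ratio J \<pi>)"
proof (rule eq_vecI)
  fix i assume "i < dim_vec (reverse_complement (J - 1) (cumulative_ratio J \<pi>))"
  then have i: "i < J - 1" by (simp add: reverse_complement_def)
  have "(\<Sum>j = 1..i + 1. cat_prob J (permute_vec J (reverse_perm J) \<pi>) j) =
      (\<Sum>j = 1..i + 1. cat_prob J \<pi> (J - j + 1))"
    using i by (intro sum.cong cat_prob_reverse) auto
  also have "\<dots> = 1 - (\<Sum>j = 1..J - (i + 1). cat_prob J \<pi> j)"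
    using i by (intro sum_cat_prob_reverse) auto
  also have "J - (i + 1) = J - 1 - 1 - i + 1" using i by simp
  finally show "cumulative_ratio J (permute_vec J (reverse_perm J) \<pi>) $ i =
      reverse_complement (J - 1) (cumulative_ratio J \<pi>) $ i"
    using i by (simp add: cumulative_ratio_def reverse_complement_def)
qed (simp add: cumulative_ratio_def reverse_complement_def)

section \<open>Stability under reversal\<close>

lemma model_eq_sym: "model_eq J X m m' \<Longrightarrow> model_eq J X m' m"
  by (simp add: model_eq_def)

text \<open>Isolates the behaviour under reversal that both ratios share, so that the stability
  argument is made once.\<close>

locale reversible_ratio =
  fixes J :: nat and r :: "real vec \<Rightarrow> real vec"
  assumes J: "J \<ge> 2"
    and ratio_carrier: "\<pi> \<in> prob_vecs J \<Longrightarrow> r \<pi> \<in> carrier_vec (J - 1)"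
    and ratio_reverse: "\<pi> \<in> prob_vecs J \<Longrightarrow>
      r (permute_vec J (reverse_perm J) \<pi>) = reverse_complement (J - 1) (r \<pi>)"
begin

lemma reverse_complement_in_ratio_image:
  assumes "y \<in> carrier_vec (J - 1)"
  shows "reverse_complement (J - 1) y \<in> r ` prob_vecs J \<longleftrightarrow> y \<in> r ` prob_vecs J"
proof -
  have "reverse_complement (J - 1) z \<in> r ` prob_vecs J" if "z \<in> r ` prob_vecs J" for z
  proof -
    from that obtain \<pi> where \<pi>: "\<pi> \<in> prob_vecs J" and z: "z = r \<pi>" by blast
    show ?thesis
      unfolding z ratio_reverse[OF \<pi>, symmetric]
      using permute_vec_reverse_in_prob_vecs[OF \<pi> J] by blast
  qed
  \<comment> \<open>One inclusion, used at \<open>y\<close> and at its image under the involution,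
    gives both directions.\<close>
  from this[of y] this[of "reverse_complement (J - 1) y"] show ?thesis
    unfolding reverse_complement_involution[OF assms] by blast
qed

text \<open>The linked predictor of the second model is the reversed complement of that of the
  first. Since reversing \<pi> has the same effect on the ratio, both models impose equivalent
  conditions on \<pi>.\<close>

lemma reversed_model_eq:
  assumes Z: "\<And>x. Z x \<in> carrier_mat (J - 1) q"
  shows "model_eq J X (permute_model (reverse_perm J) (Model r F q Z id))
    (Model r (reflect F) q (neg_reverse_rows Z) id)"
    (is "model_eq J X ?m ?m'")
proof -
  let ?n = "J - 1"
  let ?\<eta> = "\<lambda>x \<beta>. Z x *\<^sub>v \<beta>" and ?\<eta>' = "\<lambda>x \<beta>. neg_reverse_rows Z x *\<^sub>v \<beta>"
  have dim: "dim_row (Z x) = ?n" "dim_col (Z x) = q" for x using Z[of x] by auto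
  have \<eta>: "?\<eta> x \<beta> \<in> carrier_vec ?n" for x \<beta>
    by (rule carrier_vecI) (simp add: dim)
  have dim': "dim_vec (?\<eta>' x \<beta>) = ?n" for x \<beta>
    by (simp add: neg_reverse_rows_def dim)
  \<comment> \<open>The scalar product runs over the dimension of \<open>\<beta>\<close>, which has
    to match the number of columns for the entries to be defined.\<close>
  have \<eta>': "?\<eta>' x \<beta> $ i = - ?\<eta> x \<beta> $ (?n - 1 - i)"
    if "\<beta> \<in> carrier_vec q" "i < ?n" for x \<beta> i
    using that by (simp add: neg_reverse_rows_def dim scalar_prod_def sum_negf)
  have link: "map_vec (reflect F) (?\<eta>' x \<beta>) = reverse_complement ?n (map_vec F (?\<eta> x \<beta>))"
    if "\<beta> \<in> carrier_vec q" for x \<beta>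
  proof (rule eq_vecI)
    fix i assume "i < dim_vec (reverse_complement ?n (map_vec F (?\<eta> x \<beta>)))"
    then have i: "i < ?n" by (simp add: reverse_complement_def)
    have "map_vec (reflect F) (?\<eta>' x \<beta>) $ i = 1 - F (?\<eta> x \<beta> $ (?n - 1 - i))"
      using i dim'[of x \<beta>] \<eta>'[OF that i] by (simp only: index_map_vec reflect_def minus_minus)
    also have "\<dots> = reverse_complement ?n (map_vec F (?\<eta> x \<beta>)) $ i"
      using i by (simp add: reverse_complement_def dim)
    finally show "map_vec (reflect F) (?\<eta>' x \<beta>) $ i =
        reverse_complement ?n (map_vec F (?\<eta> x \<beta>)) $ i" .
  qed (simp add: reverse_complement_def neg_reverse_rows_def dim)
  have support: "(\<forall>i < ?n. ?\<eta>' x \<beta> $ i \<in> open_support (reflect F)) \<longleftrightarrow>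
      (\<forall>i < ?n. ?\<eta> x \<beta> $ i \<in> open_support F)"
    if "\<beta> \<in> carrier_vec q" for x \<beta>
  proof -
    have "(\<forall>i < ?n. ?\<eta>' x \<beta> $ i \<in> open_support (reflect F)) \<longleftrightarrow>
        (\<forall>i < ?n. ?\<eta> x \<beta> $ (?n - 1 - i) \<in> open_support F)"
      using \<eta>'[OF that] by (simp only: open_support_reflect minus_minus cong: imp_cong)
    also have "\<dots> \<longleftrightarrow> (\<forall>i < ?n. ?\<eta> x \<beta> $ i \<in> open_support F)"
    proof (intro iffI allI impI)
      fix i assume *: "\<forall>i < ?n. ?\<eta> x \<beta> $ (?n - 1 - i) \<in> open_support F" and i: "i < ?n"
      have "?n - 1 - i < ?n" "?n - 1 - (?n - 1 - i) = i" using i by auto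
      then show "?\<eta> x \<beta> $ i \<in> open_support F" using * by metis
    next
      fix i assume *: "\<forall>i < ?n. ?\<eta> x \<beta> $ i \<in> open_support F" and i: "i < ?n"
      have "?n - 1 - i < ?n" using i by simp
      then show "?\<eta> x \<beta> $ (?n - 1 - i) \<in> open_support F" using * by blast
    qed
    finally show ?thesis .
  qed
  have image: "map_vec (reflect F) (?\<eta>' x \<beta>) \<in> r ` prob_vecs J \<longleftrightarrow>
      map_vec F (?\<eta> x \<beta>) \<in> r ` prob_vecs J" if "\<beta> \<in> carrier_vec q" for x \<beta>
    unfolding link[OF that] using \<eta> by (intro reverse_complement_in_ratio_image) simp
  have "param_space J X ?m = param_space J X ?m'"
    unfolding param_space_def predictor_def permute_model_def model.sel
    using support image by (intro Collect_cong conj_cong refl) simp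
  moreover have "model_prob J ?m x \<beta> = model_prob J ?m' x \<beta>" if "\<beta> \<in> param_space J X ?m" for x \<beta>
  proof -
    let ?y = "map_vec F (?\<eta> x \<beta>)"
    have \<beta>: "\<beta> \<in> carrier_vec q" using that by (simp add: param_space_def permute_model_def)
    have y: "?y \<in> carrier_vec ?n" using \<eta> by simp
    \<comment> \<open>After rewriting, the involution is applied to both sides of the equation. The
      predicates under the two definite descriptions then agree.\<close>
    have "r (permute_vec J (reverse_perm J) \<pi>) = ?y \<longleftrightarrow>
        r (permute_vec J id \<pi>) = reverse_complement ?n ?y" if \<pi>: "\<pi> \<in> prob_vecs J" for \<pi>
      unfolding ratio_reverse[OF \<pi>] permute_vec_id[OF \<pi>]
      using reverse_complement_involution[OF y]
        reverse_complement_involution[OF ratio_carrier[OF \<pi>]] by auto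
    then have "\<pi> \<in> prob_vecs J \<and> r (permute_vec J (reverse_perm J) \<pi>) = ?y \<longleftrightarrow>
        \<pi> \<in> prob_vecs J \<and> r (permute_vec J id \<pi>) = map_vec (reflect F) (?\<eta>' x \<beta>)" for \<pi>
      unfolding link[OF \<beta>] by blast
    then show ?thesis
      unfolding model_prob_def predictor_def permute_model_def model.sel comp_id by presburger
  qed
  ultimately show ?thesis by (simp add: model_eq_def) (simp add: permute_model_def)
qed

lemma stable_under_reverse: "stable_under J X (reverse_perm J) (model_family J p r)"
proof -
  \<comment> \<open>The number \<open>q\<close> of columns is unchanged, so its bounds carry
    over.\<close>
  have dual: "Model r (reflect F) q (neg_reverse_rows Z) id \<in> model_family J p r"
    if "F \<in> link_cdfs" "J - 1 + p \<le> q" "q \<le> (J - 1) * (1 + p)" "Z \<in> designs J p q" for F q Z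
    using that reflect_in_link_cdfs neg_reverse_rows_in_designs unfolding model_family_def by blast
  show ?thesis
    unfolding stable_under_def
  proof (intro conjI ballI)
    fix m assume "m \<in> permute_model (reverse_perm J) ` model_family J p r"
    then obtain F q Z where m: "m = permute_model (reverse_perm J) (Model r F q Z id)"
      and FZ: "F \<in> link_cdfs" "J - 1 + p \<le> q" "q \<le> (J - 1) * (1 + p)" "Z \<in> designs J p q"
      unfolding model_family_def by blast
    show "\<exists>m' \<in> model_family J p r. model_eq J X m m'"
      unfolding m
      using reversed_model_eq[of Z, OF designs_carrier[OF FZ(4)]] dual[OF FZ] by blast
  next
    fix m' assume "m' \<in> model_family J p r"
    then obtain F q Z where m': "m' = Model r F q Z id"
      and FZ: "F \<in> link_cdfs" "J - 1 + p \<le> q" "q \<le> (J - 1) * (1 + p)" "Z \<in> designs J p q"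
      unfolding model_family_def by blast
    \<comment> \<open>The preimage of \<open>m'\<close> is its own dual: dualising twice gives back
      \<open>F\<close> and \<open>Z\<close>.\<close>
    have "model_eq J X
        (permute_model (reverse_perm J) (Model r (reflect F) q (neg_reverse_rows Z) id)) m'"
      using reversed_model_eq[of "neg_reverse_rows Z", OF designs_carrier[OF neg_reverse_rows_in_designs[OF FZ(4)]],
          where F = "reflect F"] by (simp add: m')
    then show "\<exists>m \<in> permute_model (reverse_perm J) ` model_family J p r. model_eq J X m' m"
      using dual[OF FZ] model_eq_sym by blast
  qed
qed

end

theorem corollary7:
  fixes J p :: nat and X :: "real vec set"
  assumes "J \<ge> 3" and "p \<ge> 1"
    and "X \<subseteq> carrier_vec p" and "X \<noteq> {}"
  shows "stable_under J X (reverse_perm J) (model_family J p (adjacent_ratio J)) \<and>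
    stable_under J X (reverse_perm J) (model_family J p (cumulative_ratio J))"
proof
  have J: "J \<ge> 2" using assms by simp
  interpret adj: reversible_ratio J "adjacent_ratio J"
    using J adjacent_ratio_reverse[OF _ J] by unfold_locales (auto simp: adjacent_ratio_def)
  interpret cum: reversible_ratio J "cumulative_ratio J"
    using J cumulative_ratio_reverse by unfold_locales (auto simp: cumulative_ratio_def)
  show "stable_under J X (reverse_perm J) (model_family J p (adjacent_ratio J))"
    by (rule adj.stable_under_reverse)
  show "stable_under J X (reverse_perm J) (model_family J p (cumulative_ratio J))"
    by (rule cum.stable_under_reverse)
qed

end
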